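(* Let $\mathcal{T}$ be a non-empty finite set of mutually concordant nice triples, and define $\mathcal{T}_0=\mathcal{T}$, $\mathcal{T}_{k+1}=\{S\otimes T: S,T\in\mathcal{T}_k\}$ for $k\geqslant 0$. Let $\mu_k=\mu(\mathcal{T}_k)$, $M_k=M(\mathcal{T}_k)$, $\kappa_0=\kappa(\mathcal{T})$ and $K_0=K(\mathcal{T})$. Then for every $k\geqslant0$, $$\min\{2\kappa_0-1,\mu_0\}+2k\leqslant\mu_k\leqslant M_k\leqslant\max\{2K_0-1,M_0\}+2k.$$
   Context: Let $S=\{0,1,*\}$; elements of $S^d$ are strings of length $d$. For $u,v\in S^d$ let $\mathrm{dist}(u,v)$ be the number of positions $i$ with $u_i\neq v_i$ and $u_i,v_i\in\{0,1\}$. A list is a finite sequence of strings all of the same length (repetitions allowed); $|L|$ is its number of entries; $[x]$ is the one-entry list of the string $x$; $*^m$ is the string of $m$ jokers $*$. A list $[v_1,\dots,v_n]$ is $k$-neighborly if $1\leqslant\mathrm{dist}(v_i,v_j)\leqslant k$ for all $i\neq j$; a sublist is obtained by deleting entries. Operations: pairing $[v_1,\dots,v_n]\ominus[w_1,\dots,w_n]=[v_1w_1,\dots,v_nw_n]$; concatenation $AB=[v_iw_j]$ (all pairs, ordered lexicographically in $(i,j)$); sum $A+B$ = entries of $A$ followed by entries of $B$; $1\cdot A=A$, $(k+1)\cdot A=k\cdot A+A$; concatenation before sum. A triple $T=(A,B,C)$ of lists is nice if: (1) $\mathrm{dist}(u,v)\leqslant1$ for all entries $u,v$ of $A$; (2)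 $|A|=|B|$ and $A\ominus B$ is $2$-neighborly; (3) $C$ is a $1$-neighborly sublist of $B$ and $\mathrm{dist}(u,v)\leqslant 1$ for all entries $u$ of $B$, $v$ of $C$. $\alpha(T)$, $\beta(T)$ are the lengths of the strings in $A$, $B$; $g(T)=|C|$. Triples $T=(A,B,C)$, $T'=(A',B',C')$ are concordant if $\alpha(T)=\alpha(T')$ and $\mathrm{dist}(u,v)\leqslant1$ for all entries $u,v$ of $A+A'$; "mutually concordant" means every two (not necessarily distinct) members are concordant. Their compound is $T\otimes T'=(A'',B'',C'')$ with $A''=[0]A+[0]A'+[1]\big((g(T)g(T'))\cdot[*^{\alpha(T)}]\big)$, $B''=[0]B[*^{\beta(T')}]+[1][*^{\beta(T)}]B'+[*]CC'$, $C''=[0]C[*^{\beta(T')}]+[1][*^{\beta(T)}]C'$. For a list $L$, let $\mu(L)$ and $M(L)$ be the minimum and maximum, over entries $w$ of $L$, of the number of positions of $w$ occupied by $0$ or $1$. For a triple $T=(A,B,C)$ set $\mu(T)=\mu(A\ominus B)$, $M(T)=M(A\ominus B)$, $\kappa(T)=\mu(C)$, $K(T)=M(C)$. For a non-empty finite set $\mathcal{S}$ of triples, $\mu(\mathcal{S})=\min_{T\in\mathcal{S}}\mu(T)$, $M(\mathcal{S})=\max_{T\in\mathcal{S}}M(T)$, $\kappa(\mathcal{S})=\min_{T\in\mathcal{S}}\kappa(T)$, $K(\mathcal{S})=\max_{T\in\mathcal{S}}K(T)$. *)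

theory Defs
  imports Complex_Main "HOL-Library.Sublist" "HOL-Library.Extended_Real"
begin

datatype letter = Zero | One | Joker

type_synonym str = "letter list"
type_synonym triple = "str list \<times> str list \<times> str list"

definition dist_str :: "str \<Rightarrow> str \<Rightarrow> nat" where
  "dist_str u v = card {i. i < length u \<and> i < length v \<and>
     u ! i \<noteq> v ! i \<and> u ! i \<in> {Zero, One} \<and> v ! i \<in> {Zero, One}}"

definition uniform :: "str list \<Rightarrow> bool" where
  "uniform L \<longleftrightarrow> (\<forall>u\<in>set L. \<forall>v\<in>set L. length u = length v)"

definition neighborly :: "nat \<Rightarrow> str list \<Rightarrow> bool" where
  "neighborly k L \<longleftrightarrow> (\<forall>i<length L. \<forall>j<length L. i \<noteq> j \<longrightarrow>
     1 \<le> dist_str (L ! i) (L ! j) \<and> dist_str (L ! i) (L ! j) \<le> k)"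

definition jokers :: "nat \<Rightarrow> str" where
  "jokers m = replicate m Joker"

definition pairing :: "str list \<Rightarrow> str list \<Rightarrow> str list" (infixl "\<ominus>" 70) where
  "V \<ominus> W = map2 (@) V W"

definition conc :: "str list \<Rightarrow> str list \<Rightarrow> str list" (infixr "\<cdot>" 75) where
  "V \<cdot> W = [v @ w. v \<leftarrow> V, w \<leftarrow> W]"

text \<open>The sum of lists is \<^term>\<open>(@)\<close>, and \<^term>\<open>conc\<close> is their concatenation;
  the \<open>k\<close>-fold multiple of \<open>L\<close> is \<open>L + \<dots> + L\<close>, empty for \<open>k = 0\<close>.\<close>

definition mult :: "nat \<Rightarrow> str list \<Rightarrow> str list" where
  "mult k L = concat (replicate k L)"

text \<open>The string lengths are read off the first entry. This is only meaningful for
  non-empty lists of strings of equal length, which is part of niceness below.\<close>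

fun alpha :: "triple \<Rightarrow> nat" where
  "alpha (A, B, C) = length (hd A)"

fun beta :: "triple \<Rightarrow> nat" where
  "beta (A, B, C) = length (hd B)"

fun g :: "triple \<Rightarrow> nat" where
  "g (A, B, C) = length C"

text \<open>The list \<open>A\<close> (hence \<open>B\<close>) is required to be non-empty, so that the string lengths and
  the extremal weights of \<open>A \<ominus> B\<close> make sense; \<open>C\<close> may be empty. A sublist in the sense of
  deleting entries is \<^const>\<open>subseq\<close>.\<close>

fun nice :: "triple \<Rightarrow> bool" where
  "nice (A, B, C) \<longleftrightarrow>
     A \<noteq> [] \<and> uniform A \<and> uniform B \<and>
     (\<forall>u\<in>set A. \<forall>v\<in>set A. dist_str u v \<le> 1) \<and>
     length A = length B \<and> neighborly 2 (A \<ominus> B) \<and>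
     subseq C B \<and> neighborly 1 C \<and>
     (\<forall>u\<in>set B. \<forall>v\<in>set C. dist_str u v \<le> 1)"

fun concordant :: "triple \<Rightarrow> triple \<Rightarrow> bool" where
  "concordant (A, B, C) (A', B', C') \<longleftrightarrow>
     alpha (A, B, C) = alpha (A', B', C') \<and>
     (\<forall>u\<in>set (A @ A'). \<forall>v\<in>set (A @ A'). dist_str u v \<le> 1)"

definition mutually_concordant :: "triple set \<Rightarrow> bool" where
  "mutually_concordant \<T> \<longleftrightarrow> (\<forall>S\<in>\<T>. \<forall>T\<in>\<T>. concordant S T)"

fun compound :: "triple \<Rightarrow> triple \<Rightarrow> triple" (infixl "\<otimes>" 70) where
  "(A, B, C) \<otimes> (A', B', C') =
     (let a = alpha (A, B, C); b = beta (A, B, C); b' = beta (A', B', C');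
          n = g (A, B, C) * g (A', B', C')
      in ([[Zero]] \<cdot> A @ [[Zero]] \<cdot> A' @ [[One]] \<cdot> mult n [jokers a],
          [[Zero]] \<cdot> B \<cdot> [jokers b'] @ [[One]] \<cdot> [jokers b] \<cdot> B' @ [[Joker]] \<cdot> C \<cdot> C',
          [[Zero]] \<cdot> C \<cdot> [jokers b'] @ [[One]] \<cdot> [jokers b] \<cdot> C'))"

definition weight :: "str \<Rightarrow> nat" where
  "weight w = card {i. i < length w \<and> w ! i \<in> {Zero, One}}"

text \<open>Minimum and maximum are taken in the extended reals, so that the empty list, which
  can only occur as the third component of a nice triple, has minimum \<open>\<infinity>\<close> and
  maximum \<open>-\<infinity>\<close>. On non-empty lists and on non-empty finite families the infima and
  suprema below are attained.\<close>

definition min_weight :: "str list \<Rightarrow> ereal" where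
  "min_weight L = (INF w\<in>set L. ereal (real (weight w)))"

definition max_weight :: "str list \<Rightarrow> ereal" where
  "max_weight L = (SUP w\<in>set L. ereal (real (weight w)))"

fun mu_triple :: "triple \<Rightarrow> ereal" where
  "mu_triple (A, B, C) = min_weight (A \<ominus> B)"

fun M_triple :: "triple \<Rightarrow> ereal" where
  "M_triple (A, B, C) = max_weight (A \<ominus> B)"

fun kappa_triple :: "triple \<Rightarrow> ereal" where
  "kappa_triple (A, B, C) = min_weight C"

fun K_triple :: "triple \<Rightarrow> ereal" where
  "K_triple (A, B, C) = max_weight C"

definition mu :: "triple set \<Rightarrow> ereal" where
  "mu \<S> = (INF T\<in>\<S>. mu_triple T)"

definition M :: "triple set \<Rightarrow> ereal" where
  "M \<S> = (SUP T\<in>\<S>. M_triple T)"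

definition kappa :: "triple set \<Rightarrow> ereal" where
  "kappa \<S> = (INF T\<in>\<S>. kappa_triple T)"

definition K :: "triple set \<Rightarrow> ereal" where
  "K \<S> = (SUP T\<in>\<S>. K_triple T)"

primrec iter_compound :: "triple set \<Rightarrow> nat \<Rightarrow> triple set" where
  "iter_compound \<T> 0 = \<T>"
| "iter_compound \<T> (Suc k) = {S \<otimes> T | S T. S \<in> iter_compound \<T> k \<and> T \<in> iter_compound \<T> k}"

end

theory Submission
  imports Defs
begin

text \<open>Compounding adds 1 to the weight of every entry of the third component, and every entry of
  the new pairing is either an old one with weight raised by 2 or comes from two entries
  \<open>c\<close>, \<open>c'\<close> of the third components and has weight \<open>1 + |c| + |c'|\<close>. Hence after \<open>k\<close> steps the weights
  are \<open>|c\<^sub>0| + k\<close> in the third component, and \<open>|w\<^sub>0| + 2k\<close> or \<open>|c\<^sub>0| + |c\<^sub>0'| - 1 + 2k\<close> in the pairing,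
  where \<open>w\<^sub>0\<close>, \<open>c\<^sub>0\<close>, \<open>c\<^sub>0'\<close> are entries belonging to triples of the initial family.\<close>

section \<open>Weights and the operations on lists\<close>

lemma weight_conv_filter: "weight w = length (filter (\<lambda>x. x \<in> {Zero, One}) w)"
  by (simp add: weight_def length_filter_conv_card)

lemma weight_Nil [simp]: "weight [] = 0"
  and weight_Cons [simp]: "weight (x # w) = (if x = Joker then 0 else 1) + weight w"
  and weight_append [simp]: "weight (v @ w) = weight v + weight w"
  and weight_jokers [simp]: "weight (jokers m) = 0"
  by (cases x; simp add: weight_conv_filter jokers_def)+

lemma set_conc: "set (V \<cdot> W) = {v @ w | v w. v \<in> set V \<and> w \<in> set W}"
  by (auto simp: conc_def)

lemma length_conc [simp]: "length (V \<cdot> W) = length V * length W"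
  by (induction V) (auto simp: conc_def)

lemma conc_singleton_left: "[v] \<cdot> W = map ((@) v) W"
  by (simp add: conc_def)

lemma conc_singleton_right: "V \<cdot> [w] = map (\<lambda>v. v @ w) V"
  by (simp add: conc_def)

lemma length_mult [simp]: "length (mult n L) = n * length L"
  by (induction n) (auto simp: mult_def)

lemma set_mult: "set (mult n L) \<subseteq> set L"
  by (auto simp: mult_def)

lemma pairing_append:
  "length V = length W \<Longrightarrow> (V @ V') \<ominus> (W @ W') = (V \<ominus> W) @ (V' \<ominus> W')"
  by (simp add: pairing_def)

lemma pairing_elem:
  assumes "x \<in> set (V \<ominus> W)"
  obtains v w where "x = v @ w" "v \<in> set V" "w \<in> set W"
  using assms by (auto simp: pairing_def dest: set_zip_leftD set_zip_rightD)

text \<open>Serves the first two blocks of a compound: there \<open>p\<close> puts a digit in front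
  and \<open>q\<close> also pads with jokers, so each raises every weight by a constant.\<close>

lemma weight_pairing_map:
  assumes "x \<in> set (map p V \<ominus> map q W)"
    and "\<And>v. weight (p v) = weight v + m" "\<And>w. weight (q w) = weight w + n"
  shows "\<exists>y \<in> set (V \<ominus> W). weight x = weight y + (m + n)"
  using assms by (force simp: pairing_def zip_map_map)

section \<open>A single compounding\<close>

lemma compound_length:
  assumes "length A = length B" "length A' = length B'"
    and "(A, B, C) \<otimes> (A', B', C') = (A'', B'', C'')"
  shows "length A'' = length B''"
  using assms by (auto simp: Let_def)

text \<open>An entry of \<open>C''\<close> is an entry of \<open>C\<close> or \<open>C'\<close>
  padded with jokers, which weigh nothing, behind one leading digit.\<close>

lemma compound_third_weight:
  assumes "(A, B, C) \<otimes> (A', B', C') = (A'', B'', C'')" and "x \<in> set C''"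
  obtains c where "c \<in> set C \<union> set C'" "weight x = weight c + 1"
  using assms by (fastforce simp: Let_def set_conc)

lemma compound_pairing_weight:
  assumes len: "length A = length B" "length A' = length B'"
    and comp: "(A, B, C) \<otimes> (A', B', C') = (A'', B'', C'')"
    and x: "x \<in> set (A'' \<ominus> B'')"
  shows "(\<exists>y \<in> set (A \<ominus> B) \<union> set (A' \<ominus> B'). weight x = weight y + 2) \<or>
         (\<exists>c \<in> set C. \<exists>c' \<in> set C'. weight x = weight c + weight c' + 1)"
proof -
  let ?j = "jokers (beta (A, B, C))" and ?j' = "jokers (beta (A', B', C'))"
  let ?R = "([[One]] \<cdot> mult (length C * length C') [jokers (alpha (A, B, C))]) \<ominus> ([[Joker]] \<cdot> C \<cdot> C')"
  \<comment> \<open>The pairing splits block against block: \<open>len\<close> makes the first two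
    pairs of blocks equally long, and \<open>?R\<close> pairs what remains.\<close>
  have "A'' \<ominus> B'' = (map ((@) [Zero]) A \<ominus> map (\<lambda>w. Zero # w @ ?j') B) @
      (map ((@) [Zero]) A' \<ominus> map (\<lambda>w. One # ?j @ w) B') @ ?R"
    using len comp
    by (auto simp: Let_def pairing_append conc_singleton_left conc_singleton_right comp_def)
  then consider
      (left) "x \<in> set (map ((@) [Zero]) A \<ominus> map (\<lambda>w. Zero # w @ ?j') B)"
    | (right) "x \<in> set (map ((@) [Zero]) A' \<ominus> map (\<lambda>w. One # ?j @ w) B')"
    | (third) "x \<in> set ?R"
    using x by auto
  then show ?thesis
  proof cases
    case left
    \<comment> \<open>One unit is the leading digit on the \<open>A\<close> side, the other the one
      on the \<open>B\<close> side.\<close>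
    then have "\<exists>y \<in> set (A \<ominus> B). weight x = weight y + (1 + 1)"
      by (rule weight_pairing_map) simp_all
    then show ?thesis by auto
  next
    case right
    then have "\<exists>y \<in> set (A' \<ominus> B'). weight x = weight y + (1 + 1)"
      by (rule weight_pairing_map) simp_all
    then show ?thesis by auto
  next
    case third
    \<comment> \<open>The left half is \<open>One\<close> followed by jokers only, by
      \<open>set_mult\<close>; the right half is \<open>Joker\<close> followed by \<open>c\<close>
      and \<open>c'\<close>. The extra 1 is the weight of \<open>One\<close>.\<close>
    then show ?thesis
      using set_mult by (elim pairing_elem) (fastforce simp: set_conc)
  qed
qed

section \<open>Iterated compounding\<close>

lemma iter_compound_SucE:
  assumes "(A, B, C) \<in> iter_compound \<T> (Suc k)"
  obtains A1 B1 C1 A2 B2 C2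
  where "(A1, B1, C1) \<in> iter_compound \<T> k" "(A2, B2, C2) \<in> iter_compound \<T> k"
    and "(A1, B1, C1) \<otimes> (A2, B2, C2) = (A, B, C)"
proof -
  from assms obtain S T where "S \<in> iter_compound \<T> k" "T \<in> iter_compound \<T> k" "S \<otimes> T = (A, B, C)"
    by (auto simp del: compound.simps)
  then show thesis using that by (cases S; cases T) blast
qed

lemma iter_compound_length:
  assumes "\<forall>(A, B, C) \<in> \<T>. length A = length B"
    and "(A, B, C) \<in> iter_compound \<T> k"
  shows "length A = length B"
  using assms(2)
proof (induction k arbitrary: A B C)
  case 0
  then show ?case using assms(1) by auto
next
  case (Suc k)
  from Suc.prems(1) obtain A1 B1 C1 A2 B2 C2
    where "(A1, B1, C1) \<in> iter_compound \<T> k" "(A2, B2, C2) \<in> iter_compound \<T> k"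
      and "(A1, B1, C1) \<otimes> (A2, B2, C2) = (A, B, C)"
    by (rule iter_compound_SucE)
  then show ?case using Suc.IH compound_length by blast
qed

lemma iter_compound_third_weight:
  assumes "(A, B, C) \<in> iter_compound \<T> k" "x \<in> set C"
  shows "\<exists>A0 B0 C0. (A0, B0, C0) \<in> \<T> \<and> (\<exists>c \<in> set C0. weight x = weight c + k)"
  using assms
proof (induction k arbitrary: A B C x)
  case 0
  then show ?case by auto
next
  case (Suc k)
  from Suc.prems(1) obtain A1 B1 C1 A2 B2 C2
    where T: "(A1, B1, C1) \<in> iter_compound \<T> k" "(A2, B2, C2) \<in> iter_compound \<T> k"
      and comp: "(A1, B1, C1) \<otimes> (A2, B2, C2) = (A, B, C)"
    by (rule iter_compound_SucE)
  obtain c where c: "c \<in> set C1 \<union> set C2" "weight x = weight c + 1"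
    using compound_third_weight[OF comp Suc.prems(2)] .
  then obtain A0 B0 C0 c0
    where "(A0, B0, C0) \<in> \<T>" "c0 \<in> set C0" "weight c = weight c0 + k"
    using Suc.IH[OF T(1)] Suc.IH[OF T(2)] by blast
  moreover from this c have "weight x = weight c0 + Suc k" by simp
  ultimately show ?case by blast
qed

text \<open>An entry either descends from an initial pairing, gaining 2 per step, or is created at
  some step from two third-component entries and gains 2 per step from then on. The deficit of 1 in
  the second case is fixed at creation; it is written on the left as \<open>weight x + 1\<close> to
  avoid truncated subtraction.\<close>

lemma iter_compound_pairing_weight:
  assumes len: "\<forall>(A, B, C) \<in> \<T>. length A = length B"
    and "(A, B, C) \<in> iter_compound \<T> k" "x \<in> set (A \<ominus> B)"
  shows "(\<exists>A0 B0 C0. (A0, B0, C0) \<in> \<T> \<and> (\<exists>y \<in> set (A0 \<ominus> B0). weight x = weight y + 2 * k)) \<or>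
         (\<exists>A1 B1 C1 A2 B2 C2. (A1, B1, C1) \<in> \<T> \<and> (A2, B2, C2) \<in> \<T> \<and>
           (\<exists>c \<in> set C1. \<exists>c' \<in> set C2. weight x + 1 = weight c + weight c' + 2 * k))"
  using assms(2,3)
proof (induction k arbitrary: A B C x)
  case 0
  then show ?case by auto
next
  case (Suc k)
  from Suc.prems(1) obtain A1 B1 C1 A2 B2 C2
    where T: "(A1, B1, C1) \<in> iter_compound \<T> k" "(A2, B2, C2) \<in> iter_compound \<T> k"
      and comp: "(A1, B1, C1) \<otimes> (A2, B2, C2) = (A, B, C)"
    by (rule iter_compound_SucE)
  have "length A1 = length B1" "length A2 = length B2"
    using iter_compound_length[OF len] T by blast+
  then consider
      (old) y where "y \<in> set (A1 \<ominus> B1) \<union> set (A2 \<ominus> B2)" "weight x = weight y + 2"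
    | (new) c c' where "c \<in> set C1" "c' \<in> set C2" "weight x = weight c + weight c' + 1"
    using compound_pairing_weight[OF _ _ comp Suc.prems(2)] by blast
  then show ?case
  proof cases
    case old
    \<comment> \<open>With \<open>n\<close> general, both alternatives for \<open>x\<close> at
      \<open>Suc k\<close> become those for \<open>y\<close> at \<open>k\<close>, which the
      induction hypothesis supplies.\<close>
    have shift: "weight x = n + 2 * Suc k \<longleftrightarrow> weight y = n + 2 * k"
      "weight x + 1 = n + 2 * Suc k \<longleftrightarrow> weight y + 1 = n + 2 * k" for n
      using old(2) by simp_all
    show ?thesis
      unfolding shift using old(1) Suc.IH[OF T(1)] Suc.IH[OF T(2)] by (elim UnE) simp_all
  next
    case new
    obtain A3 B3 C3 d where d: "(A3, B3, C3) \<in> \<T>" "d \<in> set C3" "weight c = weight d + k"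
      using iter_compound_third_weight[OF T(1) new(1)] by blast
    obtain A4 B4 C4 d' where d': "(A4, B4, C4) \<in> \<T>" "d' \<in> set C4" "weight c' = weight d' + k"
      using iter_compound_third_weight[OF T(2) new(2)] by blast
    \<comment> \<open>Each of \<open>c\<close>, \<open>c'\<close> has gained \<open>k\<close>, and
      creation adds 1, so the weight is the initial sum plus \<open>2 * k + 1\<close>, one less than
      \<open>2 * Suc k\<close>.\<close>
    have "weight x + 1 = weight d + weight d' + 2 * Suc k"
      using new(3) d(3) d'(3) by simp
    then show ?thesis using d d' by blast
  qed
qed

text \<open>Needed for the middle inequality, since over no entries at all the infimum would be
  infinite and the supremum minus infinity. Compounding a triple with itself keeps a copy of
  \<open>A\<close>.\<close>

lemma iter_compound_nonempty:
  assumes "\<T> \<noteq> {}" and "\<forall>(A, B, C) \<in> \<T>. A \<noteq> []"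
  shows "\<exists>A B C. (A, B, C) \<in> iter_compound \<T> k \<and> A \<noteq> []"
proof (induction k)
  case 0
  then show ?case using assms by auto
next
  case (Suc k)
  then obtain A B C where T: "(A, B, C) \<in> iter_compound \<T> k" "A \<noteq> []" by blast
  obtain A' B' C' where T': "(A, B, C) \<otimes> (A, B, C) = (A', B', C')"
    by (metis prod_cases3)
  then have "A' \<noteq> []" using T(2) by (auto simp: Let_def conc_singleton_left)
  moreover have "(A', B', C') \<in> iter_compound \<T> (Suc k)"
    using T(1) T'[symmetric] unfolding iter_compound.simps by blast
  ultimately show ?case by blast
qed

section \<open>Extremal weights over families\<close>

lemma mu_le_weight: "(A, B, C) \<in> \<S> \<Longrightarrow> x \<in> set (A \<ominus> B) \<Longrightarrow> mu \<S> \<le> ereal (real (weight x))"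
  unfolding mu_def
  by (rule INF_lower2[of "(A, B, C)"]) (auto simp: min_weight_def intro: INF_lower)

lemma weight_le_M: "(A, B, C) \<in> \<S> \<Longrightarrow> x \<in> set (A \<ominus> B) \<Longrightarrow> ereal (real (weight x)) \<le> M \<S>"
  unfolding M_def
  by (rule SUP_upper2[of "(A, B, C)"]) (auto simp: max_weight_def intro: SUP_upper)

lemma kappa_le_weight: "(A, B, C) \<in> \<S> \<Longrightarrow> x \<in> set C \<Longrightarrow> kappa \<S> \<le> ereal (real (weight x))"
  unfolding kappa_def
  by (rule INF_lower2[of "(A, B, C)"]) (auto simp: min_weight_def intro: INF_lower)

lemma weight_le_K: "(A, B, C) \<in> \<S> \<Longrightarrow> x \<in> set C \<Longrightarrow> ereal (real (weight x)) \<le> K \<S>"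
  unfolding K_def
  by (rule SUP_upper2[of "(A, B, C)"]) (auto simp: max_weight_def intro: SUP_upper)

lemma le_muI:
  assumes "\<And>A B C x. (A, B, C) \<in> \<S> \<Longrightarrow> x \<in> set (A \<ominus> B) \<Longrightarrow> b \<le> ereal (real (weight x))"
  shows "b \<le> mu \<S>"
  using assms by (auto simp: mu_def min_weight_def intro!: INF_greatest)

lemma M_leI:
  assumes "\<And>A B C x. (A, B, C) \<in> \<S> \<Longrightarrow> x \<in> set (A \<ominus> B) \<Longrightarrow> ereal (real (weight x)) \<le> b"
  shows "M \<S> \<le> b"
  using assms by (auto simp: M_def max_weight_def intro!: SUP_least)

text \<open>Here \<open>p\<close> will be \<open>kappa\<close>, which may be infinite. The upper
  bound \<open>ereal a\<close> excludes plus infinity, minus infinity makes the left side minus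
  infinity, and the real case is linear arithmetic.\<close>

lemma ereal_double_minus_one_le:
  assumes "p \<le> ereal a" "p \<le> ereal b" "x + 1 = a + b + 2 * c"
  shows "2 * p - 1 + 2 * ereal c \<le> ereal x"
  using assms by (cases p) (auto simp: one_ereal_def)

lemma ereal_le_double_minus_one:
  assumes "ereal a \<le> p" "ereal b \<le> p" "x + 1 = a + b + 2 * c"
  shows "ereal x \<le> 2 * p - 1 + 2 * ereal c"
  using assms by (cases p) (auto simp: one_ereal_def)

text \<open>Inherited entries are controlled by \<open>mu\<close>, created ones by
  \<open>kappa\<close>. If all third components are empty, \<open>kappa\<close> is infinite, the
  minimum is \<open>mu\<close>, and no created entries arise.\<close>

lemma mu_iter_compound_ge:
  assumes "\<forall>(A, B, C) \<in> \<T>. length A = length B"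
  shows "min (2 * kappa \<T> - 1) (mu \<T>) + 2 * ereal (real k) \<le> mu (iter_compound \<T> k)"
proof (rule le_muI)
  fix A B C x assume "(A, B, C) \<in> iter_compound \<T> k" "x \<in> set (A \<ominus> B)"
  from iter_compound_pairing_weight[OF assms this]
  consider (old) A0 B0 C0 y where "(A0, B0, C0) \<in> \<T>" "y \<in> set (A0 \<ominus> B0)"
      "weight x = weight y + 2 * k"
    | (new) A1 B1 C1 A2 B2 C2 c c' where "(A1, B1, C1) \<in> \<T>" "(A2, B2, C2) \<in> \<T>"
      "c \<in> set C1" "c' \<in> set C2" "weight x + 1 = weight c + weight c' + 2 * k"
    by blast
  then show "min (2 * kappa \<T> - 1) (mu \<T>) + 2 * ereal (real k) \<le> ereal (real (weight x))"
  proof cases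
    case old
    have "min (2 * kappa \<T> - 1) (mu \<T>) + 2 * ereal (real k)
        \<le> ereal (real (weight y)) + 2 * ereal (real k)"
      using mu_le_weight[OF old(1,2)] by (intro add_right_mono) (simp add: min.coboundedI2)
    then show ?thesis using old(3) by simp
  next
    case new
    have "real (weight x) + 1 = real (weight c) + real (weight c') + 2 * real k"
      using new(5) by linarith
    from ereal_double_minus_one_le[OF kappa_le_weight[OF new(1,3)] kappa_le_weight[OF new(2,4)] this]
    \<comment> \<open>The bound in terms of \<open>kappa\<close> alone is weakened to the
      minimum.\<close>
    show ?thesis by (rule order_trans[rotated]) (intro add_right_mono min.cobounded1)
  qed
qed

lemma M_iter_compound_le:
  assumes "\<forall>(A, B, C) \<in> \<T>. length A = length B"
  shows "M (iter_compound \<T> k) \<le> max (2 * K \<T> - 1) (M \<T>) + 2 * ereal (real k)"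
proof (rule M_leI)
  fix A B C x assume "(A, B, C) \<in> iter_compound \<T> k" "x \<in> set (A \<ominus> B)"
  from iter_compound_pairing_weight[OF assms this]
  consider (old) A0 B0 C0 y where "(A0, B0, C0) \<in> \<T>" "y \<in> set (A0 \<ominus> B0)"
      "weight x = weight y + 2 * k"
    | (new) A1 B1 C1 A2 B2 C2 c c' where "(A1, B1, C1) \<in> \<T>" "(A2, B2, C2) \<in> \<T>"
      "c \<in> set C1" "c' \<in> set C2" "weight x + 1 = weight c + weight c' + 2 * k"
    by blast
  then show "ereal (real (weight x)) \<le> max (2 * K \<T> - 1) (M \<T>) + 2 * ereal (real k)"
  proof cases
    case old
    have "ereal (real (weight y)) + 2 * ereal (real k)
        \<le> max (2 * K \<T> - 1) (M \<T>) + 2 * ereal (real k)"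
      using weight_le_M[OF old(1,2)] by (intro add_right_mono) (simp add: max.coboundedI2)
    then show ?thesis using old(3) by simp
  next
    case new
    have "real (weight x) + 1 = real (weight c) + real (weight c') + 2 * real k"
      using new(5) by linarith
    from ereal_le_double_minus_one[OF weight_le_K[OF new(1,3)] weight_le_K[OF new(2,4)] this]
    show ?thesis by (rule order_trans) (intro add_right_mono max.cobounded1)
  qed
qed

theorem theorem6:
  fixes \<T> :: "triple set" and k :: nat
  assumes "finite \<T>" and "\<T> \<noteq> {}"
    and "\<forall>T\<in>\<T>. nice T"
    and "mutually_concordant \<T>"
  shows "min (2 * kappa \<T> - 1) (mu \<T>) + 2 * ereal (real k) \<le> mu (iter_compound \<T> k)
       \<and> mu (iter_compound \<T> k) \<le> M (iter_compound \<T> k)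
       \<and> M (iter_compound \<T> k) \<le> max (2 * K \<T> - 1) (M \<T>) + 2 * ereal (real k)"
proof -
  have len: "\<forall>(A, B, C) \<in> \<T>. length A = length B"
    and ne: "\<forall>(A, B, C) \<in> \<T>. A \<noteq> []"
    using assms(3) by fastforce+
  obtain A B C where T: "(A, B, C) \<in> iter_compound \<T> k" "A \<noteq> []"
    using iter_compound_nonempty[OF assms(2) ne] by blast
  then have "length A = length B"
    using iter_compound_length[OF len] by blast
  with T(2) have "A \<ominus> B \<noteq> []" by (auto simp: pairing_def)
  \<comment> \<open>The weight of any single entry separates the infimum from the supremum; the head
    is a convenient choice.\<close>
  then have "hd (A \<ominus> B) \<in> set (A \<ominus> B)" by simp
  then have "mu (iter_compound \<T> k) \<le> M (iter_compound \<T> k)"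
    using mu_le_weight[OF T(1)] weight_le_M[OF T(1)] order_trans by blast
  then show ?thesis
    using mu_iter_compound_ge[OF len] M_iter_compound_le[OF len] by blast
qed

end
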